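(* Let $q,a,b,c,d$ be complex numbers with $0<|q|<1$ and $c,d\neq 0$, such that none of $a,b,c,d$ belongs to $\{q^{-m}: m=0,1,2,\dots\}$ (so that no denominator below vanishes). Then \begin{multline*} \sum_{n=0}^\infty \frac{(c,d;q)_n\,(abq^{n-1};q)_n\, q^n}{(q,a,b;q)_n}\\ =\frac{(c,d;q)_\infty}{(q,a;q)_\infty} \sum_{n=0}^\infty \frac{b^nq^{n^2}}{(q,b;q)_n} \left(\sum_{k=0}^\infty \frac{(aq^{-n}/d,aq^{-n}/c;q)_k\, (cd)^k\, q^{k^2+2nk}\,(1-aq^{2k})}{(cq^{n},dq^{n};q)_{k+1}}\right). \end{multline*}
   Context: For a complex number $q$ with $|q|<1$: $(x;q)_0=1$, $(x;q)_n=(1-x)(1-xq)\cdots(1-xq^{n-1})$ for $n\ge 1$, and $(x;q)_\infty=\prod_{n=0}^\infty(1-xq^n)$. For $n$ a nonnegative integer or $n=\infty$, $(x_1,\dots,x_m;q)_n=(x_1;q)_n\cdots(x_m;q)_n$. *)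

theory Defs
  imports "HOL-Analysis.Analysis"
begin

definition qpoch :: "complex \<Rightarrow> complex \<Rightarrow> nat \<Rightarrow> complex"
  where "qpoch x q n = (\<Prod>k<n. 1 - x * q ^ k)"

definition qpoch_inf :: "complex \<Rightarrow> complex \<Rightarrow> complex"
  where "qpoch_inf x q = (\<Prod>k. 1 - x * q ^ k)"

(* The infinite product is a genuine one for norm q < 1, including when some factor vanishes. *)
lemma qpoch_inf_convergent:
  fixes q x :: complex
  assumes "norm q < 1"
  shows "convergent_prod (\<lambda>k. 1 - x * q ^ k)"
proof -
  have "summable (\<lambda>k. norm (x * q ^ k))"
    unfolding norm_mult norm_power using assms by (intro summable_mult summable_geometric) simp
  then have "abs_convergent_prod (\<lambda>k. 1 - x * q ^ k)"
    by (simp add: abs_convergent_prod_conv_summable)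
  then show ?thesis
    by (rule abs_convergent_prod_imp_convergent_prod)
qed

end

theory Submission
  imports Defs
begin

text \<open>
  Two independent identities meet in an exchange of summations.

  The first is finite. The terminating \<open>q\<close>-Vandermonde sum, read backwards, resolves the
  quotient on the left into a convolution (\<open>qpoch_quotient_expansion\<close>):
  \<open>(abq^(n-1))_n q^n / ((q)_n (a)_n (b)_n)\<close> is the sum over \<open>j \<le> n\<close> of
  \<open>b^j q^(j^2) / ((q)_j (b)_j) \<cdot> q^(n-j) / ((q)_(n-j) (a)_(n-j))\<close>.
  Multiply by \<open>(c)_n (d)_n\<close> and sum over \<open>n = j + m\<close>. Since \<open>(c)_(j+m) = (c)_j (cq^j)_m\<close>,
  summing over \<open>m\<close> first leaves, for each \<open>j\<close>, a nonterminating basic hypergeometric series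
  2phi1 with argument \<open>q\<close> and parameters \<open>C = cq^j\<close>, \<open>D = dq^j\<close> over \<open>a\<close>. The exchange is
  legitimate because the shifted factorials of \<open>c\<close> and \<open>d\<close> and the inverses of those of \<open>q\<close>,
  \<open>a\<close> and \<open>b\<close> are bounded, so the double series is dominated by a product of two convergent
  series (\<open>dominated_sum_by_diagonals\<close>).

  The second turns that 2phi1 into the inner series on the right. Let \<open>phi q C D a\<close> be the 2phi1
  normalised by \<open>(q)_\<infinity> (a)_\<infinity> / ((C)_\<infinity> (D)_\<infinity>)\<close>. It satisfies the contiguous relation
  \<open>(1 - C) (1 - D) phi q C D a = (1 - a) + q (C - a) (D - a) phi q (Cq) (Dq) (aq^2)\<close>,
  which follows from a telescoping sum (\<open>phi_contiguous\<close>). The change of parameters multiplies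
  \<open>C\<close> and \<open>D\<close> by \<open>q\<close> and \<open>a\<close> by \<open>q^2\<close>, so iterating it produces exactly the very-well-poised
  terms with their factor \<open>1 - aq^(2k)\<close>, and the remainder after \<open>k\<close> steps carries \<open>q^(k^2)\<close> and
  tends to zero (\<open>well_poised_term_sums_phi\<close>).
\<close>

section \<open>Shifted factorials\<close>

lemma qpoch_0 [simp]: "qpoch x q 0 = 1"
  by (simp add: qpoch_def)

lemma qpoch_Suc: "qpoch x q (Suc n) = qpoch x q n * (1 - x * q ^ n)"
  by (simp add: qpoch_def)

lemma qpoch_add: "qpoch x q (m + n) = qpoch x q m * qpoch (x * q ^ m) q n"
  by (induction n) (simp_all add: qpoch_Suc power_add mult_ac)

lemma qpoch_Suc_shift: "qpoch x q (Suc n) = (1 - x) * qpoch (x * q) q n"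
  using qpoch_add[of x q 1 n] by (simp add: qpoch_def)

lemma qpoch_nonzero:
  assumes "\<And>k. x * q ^ k \<noteq> 1"
  shows "qpoch x q n \<noteq> 0"
  using assms by (auto simp: qpoch_def)

lemma mult_power_shift_neq_1:
  fixes x q :: complex
  assumes "\<And>k. x * q ^ k \<noteq> 1"
  shows "x * q ^ m * q ^ k \<noteq> 1"
  using assms[of "m + k"] by (simp add: power_add mult_ac)

lemma mult_power_neq_1_if_norm_less_1:
  fixes x q :: complex
  assumes "norm q < 1" "norm x < 1"
  shows "x * q ^ k \<noteq> 1"
proof -
  have "norm (x * q ^ k) \<le> norm x * 1"
    unfolding norm_mult norm_power using assms by (intro mult_left_mono power_le_one) auto
  with assms show ?thesis by auto
qed

section \<open>Infinite shifted factorials\<close>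

lemma qpoch_LIMSEQ:
  assumes "norm q < 1"
  shows "qpoch x q \<longlonglongrightarrow> qpoch_inf x q"
  using convergent_prod_LIMSEQ[OF qpoch_inf_convergent[OF assms, of x]]
  unfolding qpoch_def[abs_def] qpoch_inf_def
  by (subst LIMSEQ_lessThan_iff_atMost)

lemma qpoch_inf_split:
  assumes "norm q < 1"
  shows "qpoch_inf x q = qpoch x q m * qpoch_inf (x * q ^ m) q"
proof (rule LIMSEQ_unique)
  show "(\<lambda>n. qpoch x q (m + n)) \<longlonglongrightarrow> qpoch_inf x q"
    using LIMSEQ_ignore_initial_segment[OF qpoch_LIMSEQ[OF assms, of x], of m]
    by (simp add: add.commute)
  show "(\<lambda>n. qpoch x q (m + n)) \<longlonglongrightarrow> qpoch x q m * qpoch_inf (x * q ^ m) q"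
    unfolding qpoch_add by (intro tendsto_intros qpoch_LIMSEQ assms)
qed

lemma qpoch_inf_step:
  assumes "norm q < 1"
  shows "qpoch_inf x q = (1 - x) * qpoch_inf (x * q) q"
  using qpoch_inf_split[OF assms, of x 1] by (simp add: qpoch_def)

lemma qpoch_inf_nonzero:
  assumes "norm q < 1" "\<And>k. x * q ^ k \<noteq> 1"
  shows "qpoch_inf x q \<noteq> 0"
  unfolding qpoch_inf_def
  by (rule prodinf_nonzero) (use assms qpoch_inf_convergent in auto)

text \<open>
  If no factor vanishes, the tail product is the whole product divided by a partial product.
  Vanishing factors are harmless: they occur only for small exponents, so the argument applies
  after a shift.
\<close>

lemma qpoch_inf_tail_tendsto_1:
  assumes "norm q < 1"
  shows "(\<lambda>n. qpoch_inf (x * q ^ n) q) \<longlonglongrightarrow> 1"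
proof -
  have nonvanishing: "(\<lambda>n. qpoch_inf (y * q ^ n) q) \<longlonglongrightarrow> 1"
    if y: "\<And>k. y * q ^ k \<noteq> 1" for y
  proof -
    have "(\<lambda>n. qpoch_inf y q / qpoch y q n) \<longlonglongrightarrow> qpoch_inf y q / qpoch_inf y q"
      by (intro tendsto_intros qpoch_LIMSEQ qpoch_inf_nonzero assms y)
    moreover have "qpoch_inf y q / qpoch y q n = qpoch_inf (y * q ^ n) q" for n
      using qpoch_inf_split[OF assms, of y n] qpoch_nonzero[OF y, of n] by simp
    ultimately show ?thesis
      using qpoch_inf_nonzero[OF assms y] by simp
  qed
  have "(\<lambda>n. x * q ^ n) \<longlonglongrightarrow> x * 0"
    by (intro tendsto_intros LIMSEQ_power_zero assms)
  then have "\<forall>\<^sub>F n in sequentially. norm (x * q ^ n) < 1"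
    by (intro order_tendstoD(2)[where y = 0] tendsto_norm_zero) auto
  then obtain N where "norm (x * q ^ N) < 1"
    by (auto simp: eventually_sequentially)
  then have "(\<lambda>n. qpoch_inf (x * q ^ N * q ^ n) q) \<longlonglongrightarrow> 1"
    by (intro nonvanishing mult_power_neq_1_if_norm_less_1 assms)
  then have "(\<lambda>n. qpoch_inf (x * q ^ (n + N)) q) \<longlonglongrightarrow> 1"
    by (simp add: power_add mult_ac)
  then show ?thesis
    by (rule LIMSEQ_offset)
qed

lemma qpoch_inf_tail_bounded:
  assumes "norm q < 1"
  obtains B where "\<And>n. norm (qpoch_inf (x * q ^ n) q) \<le> B"
  using convergent_imp_Bseq[OF convergentI[OF qpoch_inf_tail_tendsto_1[OF assms, of x]]]
  by (auto simp: Bseq_def)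

lemma inverse_qpoch_inf_tail_bounded:
  assumes "norm q < 1"
  obtains B where "\<And>n. norm (inverse (qpoch_inf (x * q ^ n) q)) \<le> B"
proof -
  have "(\<lambda>n. inverse (qpoch_inf (x * q ^ n) q)) \<longlonglongrightarrow> inverse 1"
    by (intro tendsto_intros qpoch_inf_tail_tendsto_1 assms) auto
  from convergent_imp_Bseq[OF convergentI[OF this]] show ?thesis
    by (elim BseqE) (rule that, blast)
qed

text \<open>
  The quadratic exponent makes the ratio of consecutive terms, \<open>z q^(2n+1)\<close>, tend to zero, so there
  is convergence however large \<open>z\<close> is.
\<close>

lemma summable_power_mult_power_square:
  fixes z q :: complex
  assumes "norm q < 1"
  shows "summable (\<lambda>n. norm (z ^ n * q ^ (n\<^sup>2)))"
proof -
  have "(\<lambda>n. norm z * norm q * norm q ^ n) \<longlonglongrightarrow> norm z * norm q * 0"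
    by (intro tendsto_intros LIMSEQ_power_zero) (use assms in auto)
  then have "\<forall>\<^sub>F n in sequentially. norm z * norm q * norm q ^ n < 1 / 2"
    by (intro order_tendstoD(2)[where y = 0]) auto
  then obtain N where N: "\<And>n. n \<ge> N \<Longrightarrow> norm z * norm q * norm q ^ n < 1 / 2"
    by (auto simp: eventually_sequentially)
  show ?thesis
  proof (rule summable_ratio_test[where c = "1 / 2" and N = N])
    fix n assume "n \<ge> N"
    have "norm q ^ n * norm q ^ n \<le> norm q ^ n * 1"
      using assms by (intro mult_left_mono power_le_one) auto
    then have "norm z * norm q * (norm q ^ n * norm q ^ n) \<le> norm z * norm q * norm q ^ n"
      by (intro mult_left_mono) auto
    with N[OF \<open>n \<ge> N\<close>] have *: "norm z * norm q * (norm q ^ n * norm q ^ n) \<le> 1 / 2"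
      by linarith
    have "(Suc n)\<^sup>2 = n\<^sup>2 + n + n + 1"
      by (simp add: power2_eq_square)
    then have "norm (norm (z ^ Suc n * q ^ ((Suc n)\<^sup>2)))
        = (norm z * norm q * (norm q ^ n * norm q ^ n)) * norm (z ^ n * q ^ (n\<^sup>2))"
      by (simp add: norm_mult norm_power power_add mult_ac)
    also have "\<dots> \<le> 1 / 2 * norm (z ^ n * q ^ (n\<^sup>2))"
      by (intro mult_right_mono *) auto
    finally show "norm (norm (z ^ Suc n * q ^ ((Suc n)\<^sup>2))) \<le> 1 / 2 * norm (norm (z ^ n * q ^ (n\<^sup>2)))"
      by simp
  qed auto
qed

section \<open>Summation along diagonals\<close>

text \<open>
  Domination by a product of convergent series makes the double series absolutely summable over
  \<open>\<nat> \<times> \<nat>\<close>, so its sum may be computed row by row or diagonal by diagonal.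
\<close>

lemma dominated_sum_by_diagonals:
  fixes h :: "nat \<Rightarrow> nat \<Rightarrow> 'a::banach" and u v :: "nat \<Rightarrow> real"
  assumes u: "summable u" "\<And>j. 0 \<le> u j" and v: "summable v" "\<And>m. 0 \<le> v m"
    and bound: "\<And>j m. norm (h j m) \<le> u j * v m"
  obtains S where "(\<lambda>n. \<Sum>j\<le>n. h j (n - j)) sums S" "(\<lambda>j. \<Sum>m. h j m) sums S"
proof -
  let ?H = "\<lambda>(j, m). h j m"
  have "(\<lambda>(j, m). u j * v m) summable_on UNIV \<times> UNIV"
  proof (rule summable_on_SigmaI)
    show "((\<lambda>m. case (j, m) of (j, m) \<Rightarrow> u j * v m) has_sum u j * suminf v) UNIV" for j
      unfolding prod.case using v
      by (intro has_sum_cmult_right norm_summable_imp_has_sum summable_sums) auto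
    show "(\<lambda>j. u j * suminf v) summable_on UNIV"
      using u by (intro summable_on_cmult_left norm_summable_imp_summable_on) auto
    show "0 \<le> (case (j, m) of (j, m) \<Rightarrow> u j * v m)" for j m
      unfolding prod.case by (intro mult_nonneg_nonneg u v)
  qed
  then have "(\<lambda>x. norm (?H x)) summable_on UNIV \<times> UNIV"
    by (rule Infinite_Sum.abs_summable_on_comparison_test'[where g = "\<lambda>(j, m). u j * v m"])
      (use bound in auto)
  then have H: "(?H has_sum infsum ?H (UNIV \<times> UNIV)) (UNIV \<times> UNIV)" (is "(_ has_sum ?S) _")
    by (rule has_sum_infsum[OF Infinite_Sum.abs_summable_summable])
  have row: "((\<lambda>m. ?H (j, m)) has_sum (\<Sum>m. h j m)) UNIV" for j
  proof -
    have "summable (\<lambda>m. norm (h j m))"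
      by (rule summable_comparison_test'[where N = 0 and g = "\<lambda>m. u j * v m"])
        (use bound summable_mult[OF v(1)] in auto)
    then show ?thesis
      using norm_summable_imp_has_sum summable_sums summable_norm_cancel by fastforce
  qed
  have "((\<lambda>j. \<Sum>m. h j m) has_sum ?S) UNIV"
    by (rule has_sum_SigmaD[OF H row])
  moreover have "((\<lambda>n. \<Sum>j\<le>n. h j (n - j)) has_sum ?S) UNIV"
  proof (rule has_sum_SigmaD)
    show "((\<lambda>(n, j). h j (n - j)) has_sum ?S) (SIGMA n:UNIV. {..n})"
      by (rule iffD2[OF has_sum_reindex_bij_witness[where i = "\<lambda>(j, m). (j + m, j)"
            and j = "\<lambda>(n, j). (j, n - j)"] H]) auto
    show "((\<lambda>j. case (n, j) of (n, j) \<Rightarrow> h j (n - j)) has_sum (\<Sum>j\<le>n. h j (n - j))) {..n}" for n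
      by (simp add: has_sum_finite)
  qed
  ultimately show ?thesis
    using that by (blast intro: has_sum_imp_sums)
qed

section \<open>A contiguous relation\<close>

text \<open>
  The sum of these terms is
  \<open>(q)_\<infinity> (a)_\<infinity> / ((C)_\<infinity> (D)_\<infinity>)\<close> times the series of
  \<open>(C)_m (D)_m q^m / ((q)_m (a)_m)\<close>. With the infinite products absorbed into the terms, a shift of
  \<open>C\<close>, \<open>D\<close> or \<open>a\<close> by a power of \<open>q\<close> is a shift of the index in the corresponding factor.
\<close>

definition phi_term :: "complex \<Rightarrow> complex \<Rightarrow> complex \<Rightarrow> complex \<Rightarrow> nat \<Rightarrow> complex" where
  "phi_term q C D a m = q ^ m * qpoch_inf (q * q ^ m) q * qpoch_inf (a * q ^ m) q
     / (qpoch_inf (C * q ^ m) q * qpoch_inf (D * q ^ m) q)"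

definition phi :: "complex \<Rightarrow> complex \<Rightarrow> complex \<Rightarrow> complex \<Rightarrow> complex" where
  "phi q C D a = (\<Sum>m. phi_term q C D a m)"

text \<open>
  Each factor is a tail \<open>(x q^n)_\<infinity>\<close> or its inverse, and both converge as \<open>n\<close> grows. This gives a
  bound that is uniform in the shifts of the parameters as well, which is what the remainder of the
  iteration and the domination of the double series need.
\<close>

lemma phi_term_uniform_bound:
  assumes q: "norm q < 1"
  obtains B where "B \<ge> 0"
    and "\<And>i j k m. norm (phi_term q (C * q ^ i) (D * q ^ j) (a * q ^ k) m) \<le> B * norm q ^ m"
proof -
  obtain B1 where B1: "\<And>n. norm (qpoch_inf (q * q ^ n) q) \<le> B1"
    using qpoch_inf_tail_bounded[OF q] by blast
  obtain B2 where B2: "\<And>n. norm (qpoch_inf (a * q ^ n) q) \<le> B2"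
    using qpoch_inf_tail_bounded[OF q] by blast
  obtain B3 where B3: "\<And>n. norm (inverse (qpoch_inf (C * q ^ n) q)) \<le> B3"
    using inverse_qpoch_inf_tail_bounded[OF q] by blast
  obtain B4 where B4: "\<And>n. norm (inverse (qpoch_inf (D * q ^ n) q)) \<le> B4"
    using inverse_qpoch_inf_tail_bounded[OF q] by blast
  have nonneg: "0 \<le> B1" "0 \<le> B2" "0 \<le> B3" "0 \<le> B4"
    using B1[of 0] B2[of 0] B3[of 0] B4[of 0] norm_ge_zero order_trans by blast+
  have "norm (phi_term q (C * q ^ i) (D * q ^ j) (a * q ^ k) m)
      \<le> B1 * B2 * B3 * B4 * norm q ^ m" for i j k m
  proof -
    have "phi_term q (C * q ^ i) (D * q ^ j) (a * q ^ k) m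
        = qpoch_inf (q * q ^ m) q * qpoch_inf (a * q ^ (k + m)) q
          * inverse (qpoch_inf (C * q ^ (i + m)) q) * inverse (qpoch_inf (D * q ^ (j + m)) q) * q ^ m"
      by (simp add: phi_term_def power_add divide_simps mult_ac)
    also have "norm \<dots> \<le> B1 * B2 * B3 * B4 * norm q ^ m"
      unfolding norm_mult norm_power
      by (intro mult_mono B1 B2 B3 B4 mult_nonneg_nonneg nonneg norm_ge_zero order_refl
          zero_le_power)
    finally show ?thesis .
  qed
  with nonneg show ?thesis
    by (intro that[of "B1 * B2 * B3 * B4"]) auto
qed

lemma summable_phi_term:
  assumes "norm q < 1"
  shows "summable (phi_term q C D a)"
proof -
  obtain B where B: "\<And>i j k m. norm (phi_term q (C * q ^ i) (D * q ^ j) (a * q ^ k) m) \<le> B * norm q ^ m"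
    using phi_term_uniform_bound[OF assms] by metis
  show ?thesis
  proof (rule summable_comparison_test'[where N = 0])
    show "summable (\<lambda>m. B * norm q ^ m)"
      using assms by (intro summable_mult summable_geometric) auto
    show "norm (phi_term q C D a m) \<le> B * norm q ^ m" for m
      using B[of 0 0 0 m] by simp
  qed
qed

lemma phi_uniform_bound:
  assumes "norm q < 1"
  obtains B where "\<And>i j k. norm (phi q (C * q ^ i) (D * q ^ j) (a * q ^ k)) \<le> B"
proof -
  obtain B where B: "\<And>i j k m. norm (phi_term q (C * q ^ i) (D * q ^ j) (a * q ^ k) m) \<le> B * norm q ^ m"
    using phi_term_uniform_bound[OF assms] by metis
  have "norm (phi q (C * q ^ i) (D * q ^ j) (a * q ^ k)) \<le> (\<Sum>m. B * norm q ^ m)" for i j k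
    unfolding phi_def using assms
    by (intro norm_suminf_le B summable_mult summable_geometric) auto
  then show ?thesis by (rule that)
qed

text \<open>
  Moved to one side, the two multiples of \<open>phi\<close> combine termwise, and the combined term is the forward difference of
  \<open>U m = (q^m)_\<infinity> (aq^(m+1))_\<infinity> / ((Cq^m)_\<infinity> (Dq^m)_\<infinity>) \<cdot> p (q^m)\<close> for a suitable linear
  polynomial \<open>p\<close>. Here \<open>U 0 = 0\<close> because \<open>(1)_\<infinity> = 0\<close>, and \<open>U\<close> tends to \<open>p 0 = 1 - a\<close>, which is
  the inhomogeneous term.
\<close>

lemma phi_contiguous:
  assumes q: "norm q < 1" and C: "\<And>k. C * q ^ k \<noteq> 1" and D: "\<And>k. D * q ^ k \<noteq> 1"
  shows "(1 - C) * (1 - D) * phi q C D a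
     = (1 - a) + q * (C - a) * (D - a) * phi q (C * q) (D * q) (a * q\<^sup>2)"
proof -
  \<comment> \<open>Dividing the telescoping condition by the common factors leaves a polynomial identity in
    \<open>x = q^m\<close>. For generic \<open>C\<close> and \<open>D\<close>, at \<open>x = 1 / C\<close> and \<open>x = 1 / D\<close> it forces \<open>p (1 / C) = (1 - D) (1 - a / C)\<close> and
    \<open>p (1 / D) = (1 - C) (1 - a / D)\<close>; together with \<open>p 0 = 1 - a\<close> this determines the slope.\<close>
  define p where "p x = 1 - a + (a * C + a * D - C * D - a) * x" for x
  define U where "U m = qpoch_inf (1 * q ^ m) q * qpoch_inf (a * q * q ^ m) q
      / (qpoch_inf (C * q ^ m) q * qpoch_inf (D * q ^ m) q) * p (q ^ m)" for m
  have step: "U (Suc m) - U m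
      = (1 - C) * (1 - D) * phi_term q C D a m
        - q * (C - a) * (D - a) * phi_term q (C * q) (D * q) (a * q\<^sup>2) m" for m
  proof -
    define x where "x = q ^ m"
    define t1 where "t1 = qpoch_inf (x * q) q"
    define t2 where "t2 = qpoch_inf (a * x * q\<^sup>2) q"
    define t3 where "t3 = qpoch_inf (C * x * q) q"
    define t4 where "t4 = qpoch_inf (D * x * q) q"
    have nz: "1 - C * x \<noteq> 0" "1 - D * x \<noteq> 0"
      using C[of m] D[of m] by (auto simp: x_def)
    have t3: "t3 \<noteq> 0"
      using qpoch_inf_nonzero[OF q mult_power_shift_neq_1[OF C, where m = "Suc m"]]
      by (simp add: t3_def x_def mult_ac)
    have t4: "t4 \<noteq> 0"
      using qpoch_inf_nonzero[OF q mult_power_shift_neq_1[OF D, where m = "Suc m"]]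
      by (simp add: t4_def x_def mult_ac)
    have e1: "qpoch_inf (a * q * x) q = (1 - a * q * x) * t2"
      using qpoch_inf_step[OF q, of "a * q * x"] by (simp add: t2_def power2_eq_square mult_ac)
    have e2: "qpoch_inf (a * x) q = (1 - a * x) * ((1 - a * q * x) * t2)"
      using qpoch_inf_step[OF q, of "a * x"] e1 by (simp add: mult_ac)
    have e3: "qpoch_inf (C * x) q = (1 - C * x) * t3" "qpoch_inf (D * x) q = (1 - D * x) * t4"
      "qpoch_inf x q = (1 - x) * t1"
      unfolding t1_def t3_def t4_def by (rule qpoch_inf_step[OF q])+
    define N where "N = (1 - C * x) * (1 - D * x)"
    define T where "T = t1 * t2 / (t3 * t4)"
    have "N \<noteq> 0" using nz by (simp add: N_def)
    have U0: "U m = T * (p x * (1 - x) * (1 - a * q * x) / N)"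
      by (simp only: U_def x_def[symmetric] mult_1_left e1 e3) (simp add: T_def N_def mult_ac)
    have U1: "U (Suc m) = T * p (q * x)"
      by (simp add: U_def x_def T_def t1_def t2_def t3_def t4_def power2_eq_square mult_ac)
    have V0: "phi_term q C D a m = T * (x * (1 - a * x) * (1 - a * q * x) / N)"
      by (simp only: phi_term_def x_def[symmetric] mult.commute[of q x] e2 e3 t1_def[symmetric])
        (simp add: T_def N_def mult_ac)
    have V1: "phi_term q (C * q) (D * q) (a * q\<^sup>2) m = T * x"
      by (simp add: phi_term_def x_def T_def t1_def t2_def t3_def t4_def power2_eq_square mult_ac)
    have poly: "p (q * x) * N - p x * (1 - x) * (1 - a * q * x)
        = x * ((1 - C) * (1 - D) * (1 - a * x) * (1 - a * q * x)
            - q * (C - a) * (D - a) * N)"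
      unfolding p_def N_def by algebra
    have "U (Suc m) - U m = T * ((p (q * x) * N - p x * (1 - x) * (1 - a * q * x)) / N)"
      using \<open>N \<noteq> 0\<close> unfolding U0 U1 by (simp add: right_diff_distrib diff_divide_distrib)
    also have "\<dots> = (1 - C) * (1 - D) * phi_term q C D a m
        - q * (C - a) * (D - a) * phi_term q (C * q) (D * q) (a * q\<^sup>2) m"
      using \<open>N \<noteq> 0\<close> unfolding V0 V1 poly by (simp add: right_diff_distrib diff_divide_distrib mult_ac)
    finally show ?thesis .
  qed
  have "(\<lambda>m. p (q ^ m)) \<longlonglongrightarrow> p 0"
    unfolding p_def by (intro tendsto_intros LIMSEQ_power_zero q)
  then have "U \<longlonglongrightarrow> 1 * 1 / (1 * 1) * p 0"
    unfolding U_def[abs_def] by (intro tendsto_intros qpoch_inf_tail_tendsto_1 q) auto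
  then have "U \<longlonglongrightarrow> 1 - a"
    by (simp add: p_def)
  moreover have "U 0 = 0"
    using qpoch_inf_step[OF q, of 1] by (simp add: U_def)
  ultimately have "(\<lambda>m. U (Suc m) - U m) sums (1 - a)"
    using telescope_sums[of U "1 - a"] by simp
  moreover have "(\<lambda>m. U (Suc m) - U m) sums ((1 - C) * (1 - D) * phi q C D a
      - q * (C - a) * (D - a) * phi q (C * q) (D * q) (a * q\<^sup>2))"
    unfolding step phi_def
    by (intro sums_diff sums_mult summable_sums summable_phi_term q)
  ultimately show ?thesis
    using sums_unique2 by (fastforce simp: algebra_simps)
qed

section \<open>Expansion into the well-poised series\<close>

text \<open>
  The coefficient of the remainder after \<open>k\<close> applications of the contiguous relation.
\<close>

definition well_poised_factor :: "complex \<Rightarrow> complex \<Rightarrow> complex \<Rightarrow> complex \<Rightarrow> nat \<Rightarrow> complex" where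
  "well_poised_factor q C D a k = qpoch (a / D) q k * qpoch (a / C) q k * (C * D) ^ k * q ^ (k\<^sup>2)
     / (qpoch C q k * qpoch D q k)"

text \<open>
  The terms of a very-well-poised series with base \<open>a\<close>: a parameter \<open>q\<close> cancels the usual
  quotient \<open>(a)_k / (q)_k\<close>, and two further parameters have tended to infinity, which leaves
  \<open>q^(k^2)\<close>.
\<close>

definition well_poised_term :: "complex \<Rightarrow> complex \<Rightarrow> complex \<Rightarrow> complex \<Rightarrow> nat \<Rightarrow> complex" where
  "well_poised_term q C D a k = qpoch (a / D) q k * qpoch (a / C) q k * (C * D) ^ k * q ^ (k\<^sup>2)
     * (1 - a * q ^ (2 * k)) / (qpoch C q (k + 1) * qpoch D q (k + 1))"

text \<open>
  In the step from \<open>n\<close> to \<open>n + 1\<close> the contiguous relation is used at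
  \<open>(Cq^n, Dq^n, aq^(2n))\<close>. There \<open>q (Cq^n - aq^(2n)) (Dq^n - aq^(2n))\<close> equals
  \<open>CD q^(2n+1) (1 - aq^n / C) (1 - aq^n / D)\<close>, which supplies the next factors of the two shifted
  factorials and raises \<open>q^(n^2)\<close> to \<open>q^((n+1)^2)\<close>.
\<close>

lemma phi_iterated:
  assumes q: "norm q < 1" and C: "\<And>k. C * q ^ k \<noteq> 1" and D: "\<And>k. D * q ^ k \<noteq> 1"
    and nz: "C \<noteq> 0" "D \<noteq> 0"
  shows "phi q C D a = (\<Sum>k<n. well_poised_term q C D a k)
     + well_poised_factor q C D a n * phi q (C * q ^ n) (D * q ^ n) (a * q ^ (2 * n))"
proof (induction n)
  case 0
  then show ?case by (simp add: well_poised_factor_def)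
next
  case (Suc n)
  define x where "x = q ^ n"
  define y where "y = 1 - C * x"
  define z where "z = 1 - D * x"
  define f where "f = phi q (C * x) (D * x) (a * x\<^sup>2)"
  define f' where "f' = phi q (C * q ^ Suc n) (D * q ^ Suc n) (a * q ^ (2 * Suc n))"
  define W where "W = well_poised_factor q C D a n"
  have yz: "y \<noteq> 0" "z \<noteq> 0"
    using C[of n] D[of n] by (auto simp: x_def y_def z_def)
  have "q ^ (2 * Suc n) = x\<^sup>2 * q\<^sup>2"
    by (simp add: x_def mult_2 mult_2_right power_add power2_eq_square mult_ac)
  then have "f' = phi q (C * x * q) (D * x * q) (a * x\<^sup>2 * q\<^sup>2)"
    unfolding f'_def by (simp add: x_def mult_ac)
  then have "y * z * f = (1 - a * x\<^sup>2) + q * (C * x - a * x\<^sup>2) * (D * x - a * x\<^sup>2) * f'"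
    using phi_contiguous[OF q mult_power_shift_neq_1[OF C] mult_power_shift_neq_1[OF D],
        of n n "a * x\<^sup>2"]
    by (simp add: f_def y_def z_def x_def)
  then have f: "f = ((1 - a * x\<^sup>2) + q * (C * x - a * x\<^sup>2) * (D * x - a * x\<^sup>2) * f') / (y * z)"
    using yz by (simp add: field_simps)
  have t: "well_poised_term q C D a n = W * (1 - a * x\<^sup>2) / (y * z)"
    by (simp add: well_poised_term_def W_def well_poised_factor_def qpoch_Suc x_def y_def z_def power_mult[symmetric]
        mult.commute[of n 2])
  have "(Suc n)\<^sup>2 = n\<^sup>2 + n + n + 1"
    by (simp add: power2_eq_square)
  then have "well_poised_factor q C D a (Suc n)
      = W * ((1 - a / D * x) * (1 - a / C * x) * (C * D) * (x * x * q)) / (y * z)"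
    by (simp add: W_def well_poised_factor_def qpoch_Suc x_def y_def z_def power_add mult_ac)
  also have "(1 - a / D * x) * (1 - a / C * x) * (C * D) * (x * x * q)
      = q * (C * x - a * x\<^sup>2) * (D * x - a * x\<^sup>2)"
    using nz by (simp add: field_simps power2_eq_square)
  finally have F: "well_poised_factor q C D a (Suc n)
      = W * (q * (C * x - a * x\<^sup>2) * (D * x - a * x\<^sup>2)) / (y * z)" .
  have "W * f = well_poised_term q C D a n + well_poised_factor q C D a (Suc n) * f'"
    unfolding f t F by (simp add: distrib_left add_divide_distrib mult_ac)
  moreover have "phi q C D a = (\<Sum>k<n. well_poised_term q C D a k) + W * f"
    using Suc by (simp add: W_def f_def x_def power_mult[symmetric] mult.commute[of n 2])
  ultimately show ?case
    by (simp add: f'_def)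
qed

lemma well_poised_factor_tendsto_0:
  assumes q: "norm q < 1" and C: "\<And>k. C * q ^ k \<noteq> 1" and D: "\<And>k. D * q ^ k \<noteq> 1"
  shows "well_poised_factor q C D a \<longlonglongrightarrow> 0"
proof -
  have "(\<lambda>k. (C * D) ^ k * q ^ (k\<^sup>2)) \<longlonglongrightarrow> 0"
    using summable_LIMSEQ_zero[OF summable_power_mult_power_square[OF q]]
    by (rule tendsto_norm_zero_cancel)
  then have "(\<lambda>k. qpoch (a / D) q k * qpoch (a / C) q k * ((C * D) ^ k * q ^ (k\<^sup>2))
     / (qpoch C q k * qpoch D q k))
     \<longlonglongrightarrow> qpoch_inf (a / D) q * qpoch_inf (a / C) q * 0 / (qpoch_inf C q * qpoch_inf D q)"
    using qpoch_inf_nonzero[OF q C] qpoch_inf_nonzero[OF q D]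
    by (intro tendsto_intros qpoch_LIMSEQ q) auto
  then show ?thesis
    by (simp add: well_poised_factor_def[abs_def] mult_ac)
qed

lemma well_poised_term_sums_phi:
  assumes q: "norm q < 1" and C: "\<And>k. C * q ^ k \<noteq> 1" and D: "\<And>k. D * q ^ k \<noteq> 1"
    and nz: "C \<noteq> 0" "D \<noteq> 0"
  shows "well_poised_term q C D a sums phi q C D a"
proof -
  obtain B where B: "\<And>i j k. norm (phi q (C * q ^ i) (D * q ^ j) (a * q ^ k)) \<le> B"
    using phi_uniform_bound[OF q] by blast
  have "(\<lambda>n. well_poised_factor q C D a n * phi q (C * q ^ n) (D * q ^ n) (a * q ^ (2 * n))) \<longlonglongrightarrow> 0"
  proof (rule Lim_null_comparison)
    show "\<forall>\<^sub>F n in sequentially. norm (well_poised_factor q C D a n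
        * phi q (C * q ^ n) (D * q ^ n) (a * q ^ (2 * n))) \<le> norm (well_poised_factor q C D a n) * B"
      unfolding norm_mult by (intro always_eventually allI mult_left_mono B) auto
    show "(\<lambda>n. norm (well_poised_factor q C D a n) * B) \<longlonglongrightarrow> 0"
      by (intro tendsto_mult_left_zero tendsto_norm_zero well_poised_factor_tendsto_0 q C D)
  qed
  from tendsto_diff[OF tendsto_const[of "phi q C D a"] this]
  have "(\<lambda>n. phi q C D a - well_poised_factor q C D a n * phi q (C * q ^ n) (D * q ^ n) (a * q ^ (2 * n)))
      \<longlonglongrightarrow> phi q C D a"
    by simp
  moreover have "phi q C D a - well_poised_factor q C D a n * phi q (C * q ^ n) (D * q ^ n) (a * q ^ (2 * n))
      = (\<Sum>k<n. well_poised_term q C D a k)" for n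
    using phi_iterated[OF q C D nz, of a n] by simp
  ultimately show ?thesis
    by (simp add: sums_def)
qed

section \<open>A q-Vandermonde sum\<close>

text \<open>
  Here \<open>y\<close> is a free variable, which is what makes an induction on \<open>n\<close> possible: the left side
  satisfies \<open>(by)_(n+1) = (1 - by) (bqy)_n\<close>, so the induction hypothesis is needed for \<open>bq\<close> with
  the same \<open>y\<close>. On the right the \<open>q\<close>-Pascal rule
  \<open>1 - q^(n+1) = q^j (1 - q^(n+1-j)) + (1 - q^j)\<close> splits the sum in two, and the terms with equal
  denominators recombine because \<open>(1 - bq^j) + b (q^j - y) = 1 - by\<close>. The power of \<open>q\<close> with
  exponent \<open>0 + 1 + \<dots> + (j - 1)\<close> is kept as a sum so that it grows by one summand at each step.
\<close>

lemma q_Vandermonde: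
  fixes q b y :: complex
  assumes q: "\<And>k. q * q ^ k \<noteq> 1"
  shows "qpoch (b * y) q n / qpoch q q n
    = (\<Sum>j\<le>n. b ^ j * (\<Prod>i<j. q ^ i - y) * q ^ (\<Sum>i<j. i) * qpoch (b * q ^ j) q (n - j)
         / (qpoch q q j * qpoch q q (n - j)))"
proof (induction n arbitrary: b)
  case 0
  then show ?case by simp
next
  case (Suc n)
  define P where "P j = (\<Prod>i<j. q ^ i - y) * q ^ (\<Sum>i<j. i)" for j
  have P_Suc: "P (Suc j) = P j * (q ^ j * (q ^ j - y))" for j
    by (simp add: P_def power_add)
  define e where "e m j = b ^ j * P j * qpoch (b * q ^ j) q (m - j)" for m j
  let ?d = "\<lambda>m j. qpoch q q j * qpoch q q (m - j)"
  have "(1 - q * q ^ n) * (\<Sum>j\<le>Suc n. e (Suc n) j / ?d (Suc n) j)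
      = (\<Sum>j\<le>Suc n. q ^ j * (1 - q ^ (Suc n - j)) * e (Suc n) j / ?d (Suc n) j)
        + (\<Sum>j\<le>Suc n. (1 - q ^ j) * e (Suc n) j / ?d (Suc n) j)"
    unfolding sum_distrib_left sum.distrib[symmetric]
  proof (rule sum.cong)
    fix j assume "j \<in> {..Suc n}"
    then have "q ^ j * q ^ (Suc n - j) = q * q ^ n"
      by (simp flip: power_add)
    then have "q ^ j * (1 - q ^ (Suc n - j)) + (1 - q ^ j) = 1 - q * q ^ n"
      by (simp add: algebra_simps)
    then show "(1 - q * q ^ n) * (e (Suc n) j / ?d (Suc n) j)
        = q ^ j * (1 - q ^ (Suc n - j)) * e (Suc n) j / ?d (Suc n) j
          + (1 - q ^ j) * e (Suc n) j / ?d (Suc n) j"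
      by (metis add_divide_distrib distrib_right times_divide_eq_right)
  qed simp
  \<comment> \<open>The last term of the first sum and the initial term of the second one vanish.\<close>
  also have "(\<Sum>j\<le>Suc n. q ^ j * (1 - q ^ (Suc n - j)) * e (Suc n) j / ?d (Suc n) j)
      = (\<Sum>j\<le>n. q ^ j * e (Suc n) j / ?d n j)"
  proof -
    have "q ^ j * (1 - q ^ (Suc n - j)) * e (Suc n) j / ?d (Suc n) j = q ^ j * e (Suc n) j / ?d n j"
      if "j \<le> n" for j
      using that q[of "n - j"] by (simp add: Suc_diff_le qpoch_Suc)
    then show ?thesis by simp
  qed
  also have "(\<Sum>j\<le>Suc n. (1 - q ^ j) * e (Suc n) j / ?d (Suc n) j)
      = (\<Sum>j\<le>n. e (Suc n) (Suc j) / ?d n j)"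
  proof -
    have "(1 - q ^ Suc j) * e (Suc n) (Suc j) / ?d (Suc n) (Suc j) = e (Suc n) (Suc j) / ?d n j" for j
      using q[of j] by (simp add: qpoch_Suc)
    then show ?thesis by (subst sum.atMost_Suc_shift) simp
  qed
  also have "(\<Sum>j\<le>n. q ^ j * e (Suc n) j / ?d n j) + (\<Sum>j\<le>n. e (Suc n) (Suc j) / ?d n j)
      = (1 - b * y) * (\<Sum>j\<le>n. (b * q) ^ j * P j * qpoch (b * q * q ^ j) q (n - j) / ?d n j)"
    unfolding sum_distrib_left sum.distrib[symmetric]
  proof (rule sum.cong)
    fix j assume "j \<in> {..n}"
    define Q where "Q = qpoch (b * q * q ^ j) q (n - j)"
    have "qpoch (b * q ^ j) q (Suc n - j) = (1 - b * q ^ j) * Q"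
      using \<open>j \<in> {..n}\<close> by (simp add: Q_def Suc_diff_le qpoch_Suc_shift mult_ac)
    moreover have "qpoch (b * q ^ Suc j) q (Suc n - Suc j) = Q"
      by (simp add: Q_def mult_ac)
    ultimately have "q ^ j * e (Suc n) j + e (Suc n) (Suc j)
        = q ^ j * (b ^ j * P j * ((1 - b * q ^ j) * Q))
          + b * b ^ j * (P j * (q ^ j * (q ^ j - y))) * Q"
      by (simp add: e_def P_Suc)
    also have "\<dots> = (1 - b * y) * ((b * q) ^ j * P j * Q)"
      by (simp add: power_mult_distrib algebra_simps)
    finally have "q ^ j * e (Suc n) j + e (Suc n) (Suc j)
        = (1 - b * y) * ((b * q) ^ j * P j * qpoch (b * q * q ^ j) q (n - j))"
      unfolding Q_def .
    then show "q ^ j * e (Suc n) j / ?d n j + e (Suc n) (Suc j) / ?d n j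
        = (1 - b * y) * ((b * q) ^ j * P j * qpoch (b * q * q ^ j) q (n - j) / ?d n j)"
      by (metis add_divide_distrib times_divide_eq_right)
  qed simp
  also have "(\<Sum>j\<le>n. (b * q) ^ j * P j * qpoch (b * q * q ^ j) q (n - j) / ?d n j)
      = qpoch (b * q * y) q n / qpoch q q n"
    using Suc[of "b * q"] by (simp add: P_def mult.assoc)
  also have "(1 - b * y) * \<dots> = qpoch (b * y) q (Suc n) / qpoch q q n"
    by (simp add: qpoch_Suc_shift mult_ac)
  finally have eq: "(1 - q * q ^ n) * (\<Sum>j\<le>Suc n. e (Suc n) j / ?d (Suc n) j)
      = (1 - q * q ^ n) * (qpoch (b * y) q (Suc n) / qpoch q q (Suc n))"
    using q[of n] by (simp add: qpoch_Suc)
  have "1 - q * q ^ n \<noteq> 0"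
    using q[of n] by simp
  from eq[unfolded mult_left_cancel[OF this], symmetric] show ?case
    by (simp add: e_def P_def mult.assoc del: sum.atMost_Suc)
qed

text \<open>
  For \<open>y = aq^(n-1)\<close> each factor \<open>q^i - y\<close> equals \<open>q^i (1 - aq^(n-1-i))\<close>. These are the last \<open>j\<close>
  factors of \<open>(a)_n\<close> in reverse order, and the powers of \<open>q\<close> collect to
  \<open>j (j - 1) + j = j^2\<close>. The integer power covers \<open>n = 0\<close>, where the exponent is \<open>-1\<close>.
\<close>

lemma qpoch_reversed_tail:
  fixes q a :: complex
  assumes q0: "q \<noteq> 0" and "j \<le> n"
  shows "(\<Prod>i<j. q ^ i - a * q powi (int n - 1)) * q ^ (\<Sum>i<j. i) * q ^ j * qpoch a q (n - j)
    = q ^ (j\<^sup>2) * qpoch a q n"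
  using \<open>j \<le> n\<close>
proof (induction j)
  case 0
  then show ?case by simp
next
  case (Suc j)
  define m where "m = n - Suc j"
  have n: "n - j = Suc m" "n = m + j + 1"
    using Suc.prems by (auto simp: m_def)
  have "int n - 1 = int (m + j)"
    using n by simp
  then have "q powi (int n - 1) = q ^ (m + j)"
    by (simp only: power_int_of_nat)
  then have fac: "q ^ j - a * q powi (int n - 1) = q ^ j * (1 - a * q ^ m)"
    by (simp add: algebra_simps power_add)
  have IH: "(\<Prod>i<j. q ^ i - a * q powi (int n - 1)) * q ^ (\<Sum>i<j. i) * q ^ j
      * (qpoch a q m * (1 - a * q ^ m)) = q ^ (j\<^sup>2) * qpoch a q n"
    using Suc.IH Suc.prems by (simp add: n(1) qpoch_Suc)
  have "(\<Prod>i<Suc j. q ^ i - a * q powi (int n - 1)) * q ^ (\<Sum>i<Suc j. i) * q ^ Suc j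
        * qpoch a q (n - Suc j)
      = ((\<Prod>i<j. q ^ i - a * q powi (int n - 1)) * q ^ (\<Sum>i<j. i) * q ^ j
      * (qpoch a q m * (1 - a * q ^ m))) * (q ^ j * q ^ j * q)"
    by (simp add: fac m_def[symmetric] power_add mult_ac)
  also have "\<dots> = q ^ ((Suc j)\<^sup>2) * qpoch a q n"
    unfolding IH by (simp add: power2_eq_square power_add mult_ac)
  finally show ?case .
qed

text \<open>
  The \<open>q\<close>-Vandermonde sum at \<open>y = aq^(n-1)\<close>, divided by \<open>(a)_n (b)_n\<close>. One factor \<open>q^j\<close> of \<open>q^n\<close>
  completes the square in the exponent; the other, \<open>q^(n-j)\<close>, belongs to the second convolution
  factor.
\<close>

lemma qpoch_quotient_expansion:
  fixes q a b :: complex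
  assumes q0: "q \<noteq> 0" and q: "\<And>k. q * q ^ k \<noteq> 1"
    and a: "\<And>k. a * q ^ k \<noteq> 1" and b: "\<And>k. b * q ^ k \<noteq> 1"
  shows "qpoch (a * b * q powi (int n - 1)) q n * q ^ n / (qpoch q q n * qpoch a q n * qpoch b q n)
    = (\<Sum>j\<le>n. b ^ j * q ^ (j\<^sup>2) / (qpoch q q j * qpoch b q j)
         * (q ^ (n - j) / (qpoch q q (n - j) * qpoch a q (n - j))))"
proof -
  define y where "y = a * q powi (int n - 1)"
  note nz = qpoch_nonzero[OF q] qpoch_nonzero[OF a] qpoch_nonzero[OF b]
  have "qpoch (a * b * q powi (int n - 1)) q n * q ^ n / (qpoch q q n * qpoch a q n * qpoch b q n)
      = qpoch (b * y) q n / qpoch q q n * (q ^ n / (qpoch a q n * qpoch b q n))"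
    by (simp add: y_def mult_ac)
  also have "\<dots> = (\<Sum>j\<le>n. b ^ j * (\<Prod>i<j. q ^ i - y) * q ^ (\<Sum>i<j. i) * qpoch (b * q ^ j) q (n - j)
         / (qpoch q q j * qpoch q q (n - j)) * (q ^ n / (qpoch a q n * qpoch b q n)))"
    by (simp only: q_Vandermonde[OF q] sum_distrib_right)
  also have "\<dots> = (\<Sum>j\<le>n. b ^ j * q ^ (j\<^sup>2) / (qpoch q q j * qpoch b q j)
         * (q ^ (n - j) / (qpoch q q (n - j) * qpoch a q (n - j))))"
  proof (rule sum.cong)
    fix j assume "j \<in> {..n}"
    then have "j \<le> n" by simp
    define X where "X = (\<Prod>i<j. q ^ i - y) * q ^ (\<Sum>i<j. i)"
    have X: "X * q ^ j / qpoch a q n = q ^ (j\<^sup>2) / qpoch a q (n - j)"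
      using qpoch_reversed_tail[OF q0 \<open>j \<le> n\<close>, of a] nz
      by (simp add: X_def y_def frac_eq_eq)
    have Y: "qpoch (b * q ^ j) q (n - j) / qpoch b q n = 1 / qpoch b q j"
      using qpoch_add[of b q j "n - j"] \<open>j \<le> n\<close> nz
        qpoch_nonzero[OF mult_power_shift_neq_1[OF b], of j "n - j"] by simp
    have "q ^ n = q ^ j * q ^ (n - j)"
      using \<open>j \<le> n\<close> by (simp flip: power_add)
    then have "b ^ j * (\<Prod>i<j. q ^ i - y) * q ^ (\<Sum>i<j. i) * qpoch (b * q ^ j) q (n - j)
         / (qpoch q q j * qpoch q q (n - j)) * (q ^ n / (qpoch a q n * qpoch b q n))
      = b ^ j / (qpoch q q j * qpoch q q (n - j)) * (X * q ^ j / qpoch a q n)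
         * (qpoch (b * q ^ j) q (n - j) / qpoch b q n) * q ^ (n - j)"
      by (simp add: X_def mult_ac)
    also have "\<dots> = b ^ j * q ^ (j\<^sup>2) / (qpoch q q j * qpoch b q j)
         * (q ^ (n - j) / (qpoch q q (n - j) * qpoch a q (n - j)))"
      unfolding X Y by simp
    finally show "b ^ j * (\<Prod>i<j. q ^ i - y) * q ^ (\<Sum>i<j. i) * qpoch (b * q ^ j) q (n - j)
         / (qpoch q q j * qpoch q q (n - j)) * (q ^ n / (qpoch a q n * qpoch b q n))
      = b ^ j * q ^ (j\<^sup>2) / (qpoch q q j * qpoch b q j)
         * (q ^ (n - j) / (qpoch q q (n - j) * qpoch a q (n - j)))" .
  qed simp
  finally show ?thesis .
qed

section \<open>The transformation\<close>

lemma mult_power_neq_1_if_not_pole: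
  fixes x q :: complex
  assumes "q \<noteq> 0" "x \<notin> {q powi (- int m) | m. True}"
  shows "x * q ^ k \<noteq> 1"
proof
  assume "x * q ^ k = 1"
  then have "x = q powi (- int k)"
    using assms(1) by (simp add: power_int_minus field_simps)
  with assms(2) show False by blast
qed

text \<open>
  This undoes the normalisation of \<open>phi_term\<close>. The prefactor contains \<open>c\<close> and \<open>d\<close> themselves while
  the parameters are shifted by \<open>q^j\<close>, so the result depends on \<open>c\<close> and \<open>d\<close> only through the
  diagonal index \<open>j + m\<close>.
\<close>

lemma qpoch_mult_phi_term:
  assumes q: "norm q < 1" and a: "\<And>k. a * q ^ k \<noteq> 1"
    and c: "\<And>k. c * q ^ k \<noteq> 1" and d: "\<And>k. d * q ^ k \<noteq> 1"
  shows "qpoch_inf c q * qpoch_inf d q / (qpoch_inf q q * qpoch_inf a q)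
      * phi_term q (c * q ^ j) (d * q ^ j) a m
    = qpoch c q (j + m) * qpoch d q (j + m) * (q ^ m / (qpoch q q m * qpoch a q m))"
proof -
  note qq = mult_power_neq_1_if_norm_less_1[OF q q]
  note nz = qpoch_nonzero[OF qq] qpoch_nonzero[OF a]
    qpoch_inf_nonzero[OF q mult_power_shift_neq_1[OF qq]]
    qpoch_inf_nonzero[OF q mult_power_shift_neq_1[OF a]]
    qpoch_inf_nonzero[OF q mult_power_shift_neq_1[OF c]]
    qpoch_inf_nonzero[OF q mult_power_shift_neq_1[OF d]]
  have shift: "x * q ^ j * q ^ m = x * q ^ (j + m)" for x
    by (simp add: power_add)
  show ?thesis
    unfolding phi_term_def shift qpoch_inf_split[OF q, of c "j + m"]
      qpoch_inf_split[OF q, of d "j + m"] qpoch_inf_split[OF q, of q m]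
      qpoch_inf_split[OF q, of a m]
    using nz by (simp add: divide_simps)
qed

theorem theorem3p1:
  fixes q a b c d :: complex
  assumes "0 < norm q" and "norm q < 1"
    and "c \<noteq> 0" and "d \<noteq> 0"
    and "a \<notin> {q powi (- int m) | m. True}"
    and "b \<notin> {q powi (- int m) | m. True}"
    and "c \<notin> {q powi (- int m) | m. True}"
    and "d \<notin> {q powi (- int m) | m. True}"
  shows "let
      L = (\<lambda>n::nat. qpoch c q n * qpoch d q n * qpoch (a * b * q powi (int n - 1)) q n * q ^ n
             / (qpoch q q n * qpoch a q n * qpoch b q n));
      I = (\<lambda>n k::nat. qpoch (a * q powi (- int n) / d) q k * qpoch (a * q powi (- int n) / c) q k
             * (c * d) ^ k * q ^ (k\<^sup>2 + 2 * n * k) * (1 - a * q ^ (2 * k))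
             / (qpoch (c * q ^ n) q (k + 1) * qpoch (d * q ^ n) q (k + 1)));
      R = (\<lambda>n::nat. b ^ n * q ^ (n\<^sup>2) / (qpoch q q n * qpoch b q n) * (\<Sum>k. I n k))
    in summable L \<and> (\<forall>n. summable (I n)) \<and> summable R \<and>
       (\<Sum>n. L n) = (qpoch_inf c q * qpoch_inf d q) / (qpoch_inf q q * qpoch_inf a q) * (\<Sum>n. R n)"
proof -
  have q: "norm q < 1" and q0: "q \<noteq> 0"
    using assms(1,2) by auto
  note a = mult_power_neq_1_if_not_pole[OF q0 assms(5)]
    and b = mult_power_neq_1_if_not_pole[OF q0 assms(6)]
    and c = mult_power_neq_1_if_not_pole[OF q0 assms(7)]
    and d = mult_power_neq_1_if_not_pole[OF q0 assms(8)]
    and qq = mult_power_neq_1_if_norm_less_1[OF q q]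
  define L where "L = (\<lambda>n::nat. qpoch c q n * qpoch d q n * qpoch (a * b * q powi (int n - 1)) q n * q ^ n
             / (qpoch q q n * qpoch a q n * qpoch b q n))"
  define I where "I = (\<lambda>n k::nat. qpoch (a * q powi (- int n) / d) q k * qpoch (a * q powi (- int n) / c) q k
             * (c * d) ^ k * q ^ (k\<^sup>2 + 2 * n * k) * (1 - a * q ^ (2 * k))
             / (qpoch (c * q ^ n) q (k + 1) * qpoch (d * q ^ n) q (k + 1)))"
  define w where "w n = b ^ n * q ^ (n\<^sup>2) / (qpoch q q n * qpoch b q n)" for n
  define R where "R = (\<lambda>n::nat. w n * (\<Sum>k. I n k))"
  define K where "K = qpoch_inf c q * qpoch_inf d q / (qpoch_inf q q * qpoch_inf a q)"
  have K: "K \<noteq> 0"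
    using qpoch_inf_nonzero[OF q c] qpoch_inf_nonzero[OF q d] qpoch_inf_nonzero[OF q a]
      qpoch_inf_nonzero[OF q qq] by (simp add: K_def)

  have I_sums: "I n sums phi q (c * q ^ n) (d * q ^ n) a" for n
  proof -
    have "I n = well_poised_term q (c * q ^ n) (d * q ^ n) a"
    proof
      fix k
      have "k\<^sup>2 + 2 * n * k = n * k + n * k + k\<^sup>2"
        by simp
      then have "q ^ (k\<^sup>2 + 2 * n * k) = q ^ (n * k) * q ^ (n * k) * q ^ (k\<^sup>2)"
        by (simp only: power_add)
      then show "I n k = well_poised_term q (c * q ^ n) (d * q ^ n) a k"
        by (simp add: I_def well_poised_term_def power_int_minus power_mult_distrib field_simps
            flip: power_mult)
    qed
    then show ?thesis
      using well_poised_term_sums_phi[OF q mult_power_shift_neq_1[OF c] mult_power_shift_neq_1[OF d],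
          of n n a] assms(3,4) q0 by simp
  qed

  \<comment> \<open>The double series: its diagonals are the terms on the left, its rows those on the right.\<close>
  define h where "h j m = K * (w j * phi_term q (c * q ^ j) (d * q ^ j) a m)" for j m
  have L: "L n = (\<Sum>j\<le>n. h j (n - j))" for n
  proof -
    have "L n = qpoch c q n * qpoch d q n * (qpoch (a * b * q powi (int n - 1)) q n * q ^ n
        / (qpoch q q n * qpoch a q n * qpoch b q n))"
      by (simp add: L_def)
    also have "\<dots> = (\<Sum>j\<le>n. qpoch c q n * qpoch d q n
        * (w j * (q ^ (n - j) / (qpoch q q (n - j) * qpoch a q (n - j)))))"
      unfolding qpoch_quotient_expansion[OF q0 qq a b] w_def sum_distrib_left ..
    also have "\<dots> = (\<Sum>j\<le>n. h j (n - j))"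
    proof (rule sum.cong)
      fix j assume "j \<in> {..n}"
      have "h j (n - j) = w j * (K * phi_term q (c * q ^ j) (d * q ^ j) a (n - j))"
        by (simp add: h_def mult_ac)
      also have "K * phi_term q (c * q ^ j) (d * q ^ j) a (n - j) = qpoch c q n * qpoch d q n
          * (q ^ (n - j) / (qpoch q q (n - j) * qpoch a q (n - j)))"
        using qpoch_mult_phi_term[OF q a c d, of j "n - j"] \<open>j \<in> {..n}\<close> by (simp add: K_def)
      finally show "qpoch c q n * qpoch d q n
          * (w j * (q ^ (n - j) / (qpoch q q (n - j) * qpoch a q (n - j)))) = h j (n - j)"
        by (simp add: mult_ac)
    qed simp
    finally show ?thesis .
  qed
  have row: "(\<Sum>m. h j m) = K * R j" for j
    using summable_phi_term[OF q] sums_unique[OF I_sums]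
    by (simp add: h_def R_def phi_def suminf_mult summable_mult)

  obtain B where B: "B \<ge> 0"
    "\<And>i j k m. norm (phi_term q (c * q ^ i) (d * q ^ j) (a * q ^ k) m) \<le> B * norm q ^ m"
    using phi_term_uniform_bound[OF q] by metis
  have "summable (\<lambda>j. norm (w j))"
  proof -
    have "(\<lambda>j. 1 / (qpoch q q j * qpoch b q j)) \<longlonglongrightarrow> 1 / (qpoch_inf q q * qpoch_inf b q)"
      using qpoch_inf_nonzero[OF q qq] qpoch_inf_nonzero[OF q b]
      by (intro tendsto_intros qpoch_LIMSEQ q) auto
    then have "Bseq (\<lambda>j. 1 / (qpoch q q j * qpoch b q j))"
      by (intro convergent_imp_Bseq convergentI)
    then obtain M where M: "\<And>j. norm (1 / (qpoch q q j * qpoch b q j)) \<le> M"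
      by (auto simp: Bseq_def)
    show ?thesis
    proof (rule summable_comparison_test'[where N = 0])
      show "summable (\<lambda>j. M * norm (b ^ j * q ^ (j\<^sup>2)))"
        by (intro summable_mult summable_power_mult_power_square q)
      fix j
      have "norm (w j) = norm (1 / (qpoch q q j * qpoch b q j)) * norm (b ^ j * q ^ (j\<^sup>2))"
        unfolding w_def norm_mult[symmetric] by simp
      then show "norm (norm (w j)) \<le> M * norm (b ^ j * q ^ (j\<^sup>2))"
        using mult_right_mono[OF M[of j] norm_ge_zero[of "b ^ j * q ^ (j\<^sup>2)"]]
        by (simp only: real_norm_def abs_norm_cancel abs_mult)
    qed
  qed
  then have u: "summable (\<lambda>j. norm K * norm (w j) * B)"
    by (intro summable_mult summable_mult2)
  have "norm (h j m) \<le> norm K * norm (w j) * B * norm q ^ m" for j m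
    using mult_left_mono[OF B(2)[of j j 0 m], of "norm K * norm (w j)"]
    by (simp add: h_def norm_mult mult_ac)
  then obtain S where S: "(\<lambda>n. \<Sum>j\<le>n. h j (n - j)) sums S" "(\<lambda>j. \<Sum>m. h j m) sums S"
    using dominated_sum_by_diagonals[OF u _ summable_geometric[of "norm q"], of h] B(1) q by auto
  have "L sums S"
    using S(1) by (simp flip: L)
  moreover have "R sums (S / K)"
    using sums_divide[OF S(2), of K] K by (simp add: row)
  ultimately have "summable L \<and> (\<forall>n. summable (I n)) \<and> summable R \<and> (\<Sum>n. L n) = K * (\<Sum>n. R n)"
    using I_sums K by (auto simp: sums_iff)
  then show ?thesis
    unfolding Let_def L_def I_def R_def w_def K_def .
qed

end
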